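(* Let $a_j,b_j\in(0,\infty)$, $j=1,2$. Then the following statements are valid: (i) $\left\{\frac{m+a_1}{(m+b_1)+(m+a_1)n}\right\}_{m,n\in\mathbb{Z}_+}\in\mathcal{M}(\mathbb{Z}_+^2)$ if and only if $b_1\leq a_1$. (ii) $\left\{\frac{m+a_1}{(m+b_1)(m+b_2)+(m+a_1)n}\right\}_{m,n\in\mathbb{Z}_+}\in\mathcal{M}(\mathbb{Z}_+^2)$ if and only if $b_1\leq a_1\leq b_2$. (iii) $\left\{\frac{(m+a_1)(m+a_2)}{(m+b_1)(m+b_2)+(m+a_1)(m+a_2)n}\right\}_{m,n\in\mathbb{Z}_+}\in\mathcal{M}(\mathbb{Z}_+^2)$ if and only if $b_1\leq a_1\leq b_2$ and $b_1+b_2\leq a_1+a_2$.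
   Context: $\mathbb{Z}_+$ denotes the set of non-negative integers, and $\mathbb{Z}_+^2$ is an abelian semigroup under componentwise addition. For $d\in\mathbb{Z}_+^2$ and $g:\mathbb{Z}_+^2\to\mathbb{R}$, the backward difference is $(\nabla_d g)(s)=g(s)-g(s+d)$. A function (net) $\phi:\mathbb{Z}_+^2\to\mathbb{R}$ is completely monotone if it is nonnegative and $\nabla_{d_1}\cdots\nabla_{d_r}\phi(s)\geq 0$ for every finite collection $d_1,\dots,d_r\in\mathbb{Z}_+^2$ and every $s\in\mathbb{Z}_+^2$. $\mathcal{M}(\mathbb{Z}_+^2)$ denotes the set of completely monotone functions on $\mathbb{Z}_+^2$.
   Formalization: The "only if" of (ii) is stated for b_1≤b_2 and that of (iii) for a_1≤a_2 and b_1≤b_2; without such labelling they fail, e.g. (ii) with b_1=3, a_1=2, b_2=1, since the nets are symmetric in b_1,b_2 (and in a_1,a_2 in (iii)). *)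

theory Defs
  imports Complex_Main "HOL-Library.Product_Plus"
begin

text \<open>
  The semigroup of pairs of non-negative integers is the type \<^typ>\<open>nat \<times> nat\<close> with the
  componentwise addition of \<^theory>\<open>HOL-Library.Product_Plus\<close>.
\<close>

definition backward_diff :: "nat \<times> nat \<Rightarrow> (nat \<times> nat \<Rightarrow> real) \<Rightarrow> nat \<times> nat \<Rightarrow> real"
  where "backward_diff d g = (\<lambda>s. g s - g (s + d))"

text \<open>
  For \<open>ds = [d\<^sub>1, \<dots>, d\<^sub>r]\<close>, the term \<open>foldr backward_diff ds \<phi>\<close> is the iterated difference
  of \<open>\<phi>\<close> in the directions \<open>d\<^sub>1, \<dots>, d\<^sub>r\<close>; a list is used since repeated directions
  are allowed.
\<close>

definition completely_monotone :: "(nat \<times> nat \<Rightarrow> real) set"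
  where "completely_monotone =
    {\<phi>. (\<forall>s. 0 \<le> \<phi> s) \<and> (\<forall>ds s. 0 \<le> foldr backward_diff ds \<phi> s)}"

end

theory Submission
  imports Defs "HOL-Analysis.Harmonic_Numbers" "HOL-Real_Asymp.Real_Asymp"
begin

text \<open>
  All nets in question have the form \<open>\<phi>(m, n) = 1 / (r(m) + n)\<close> with \<open>r > 0\<close>, and such a net is
  completely monotone iff all differences of \<open>r\<close> of positive order are nonpositive.

  If \<open>f > 0\<close> has completely monotone increments, then
  \<open>\<nabla>\<^sub>d(1/f)(s) = (f(s + d) - f(s)) \<cdot> 1/f(s) \<cdot> 1/f(s + d)\<close> and the Leibniz rule show, by
  induction on the order of the differences, that \<open>1/f\<close> is completely monotone. Conversely,
  \<open>n\<^sup>2 \<cdot> \<nabla>\<^sup>k\<phi>(m, n) \<rightarrow> -\<nabla>\<^sup>k r(m)\<close> as \<open>n \<rightarrow> \<infinity>\<close> for \<open>k \<ge> 1\<close>.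

  In (iii), \<open>r(m) = 1 - p / ((m + a\<^sub>1)(m + a\<^sub>2)) - q / (m + a\<^sub>2)\<close> with
  \<open>p = (a\<^sub>1 - b\<^sub>1)(b\<^sub>2 - a\<^sub>1)\<close> and \<open>q = a\<^sub>1 + a\<^sub>2 - b\<^sub>1 - b\<^sub>2\<close>, so \<open>p, q \<ge> 0\<close> suffices. Since \<open>r\<close>
  increases to \<open>1\<close>, \<open>q \<ge> 0\<close> is necessary. So is \<open>p \<ge> 0\<close>: for \<open>a\<^sub>1 \<le> a\<^sub>2\<close>, the \<open>k\<close>-th difference of
  \<open>1 / ((m + a\<^sub>1)(m + a\<^sub>2))\<close> exceeds that of \<open>1 / (m + a\<^sub>2)\<close> by a factor which is at least a
  partial sum of the harmonic series.
\<close>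

declare split_paired_All [simp del]

section \<open>Nets monotone up to a given order\<close>

text \<open>Bounding the order lets proofs induct on \<open>k\<close>. The recursion peels off the
  innermost difference, so the net varies in these inductions.\<close>

primrec monotone_upto :: "nat \<Rightarrow> (nat \<times> nat \<Rightarrow> real) \<Rightarrow> bool" where
  "monotone_upto 0 \<phi> \<longleftrightarrow> (\<forall>s. 0 \<le> \<phi> s)"
| "monotone_upto (Suc k) \<phi> \<longleftrightarrow> (\<forall>s. 0 \<le> \<phi> s) \<and> (\<forall>d. monotone_upto k (backward_diff d \<phi>))"

lemma monotone_upto_nonneg: "monotone_upto k \<phi> \<Longrightarrow> 0 \<le> \<phi> s"
  by (cases k) auto

lemma monotone_upto_SucD: "monotone_upto (Suc k) \<phi> \<Longrightarrow> monotone_upto k \<phi>"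
  by (induction k arbitrary: \<phi>) auto

lemma foldr_backward_diff_nonneg:
  assumes "monotone_upto (length ds) \<phi>"
  shows "0 \<le> foldr backward_diff ds \<phi> s"
  using assms
\<comment> \<open>\<open>foldr\<close> applies the last direction first, so the list is taken apart
  from its end.\<close>
proof (induction ds arbitrary: \<phi> rule: rev_induct)
  case Nil
  then show ?case by simp
next
  case (snoc d ds)
  then show ?case by simp
qed

lemma completely_monotoneI:
  assumes "\<And>k. monotone_upto k \<phi>"
  shows "\<phi> \<in> completely_monotone"
  unfolding completely_monotone_def
  using assms foldr_backward_diff_nonneg monotone_upto_nonneg by blast

lemma monotone_upto_const:
  assumes "0 \<le> c"
  shows "monotone_upto k (\<lambda>s. c)"
  using assms by (induction k arbitrary: c) (auto simp: backward_diff_def)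

lemma monotone_upto_add:
  assumes "monotone_upto k \<phi>" and "monotone_upto k \<psi>"
  shows "monotone_upto k (\<lambda>s. \<phi> s + \<psi> s)"
  using assms
proof (induction k arbitrary: \<phi> \<psi>)
  case 0
  then show ?case by simp
next
  case (Suc k)
  have "backward_diff d (\<lambda>s. \<phi> s + \<psi> s) = (\<lambda>s. backward_diff d \<phi> s + backward_diff d \<psi> s)" for d
    by (simp add: backward_diff_def fun_eq_iff)
  with Suc show ?case by simp
qed

lemma monotone_upto_shift:
  assumes "monotone_upto k \<phi>"
  shows "monotone_upto k (\<lambda>s. \<phi> (s + d))"
  using assms
proof (induction k arbitrary: \<phi>)
  case 0
  then show ?case by simp
next
  case (Suc k)
  have "backward_diff e (\<lambda>s. \<phi> (s + d)) = (\<lambda>s. backward_diff e \<phi> (s + d))" for e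
    by (simp add: backward_diff_def fun_eq_iff add_ac)
  with Suc show ?case by simp
qed

text \<open>Leibniz rule with one factor shifted by \<open>d\<close>: each summand is a product of
  two nets that are monotone up to order \<open>k\<close>.\<close>

lemma monotone_upto_mult:
  assumes "monotone_upto k \<phi>" and "monotone_upto k \<psi>"
  shows "monotone_upto k (\<lambda>s. \<phi> s * \<psi> s)"
  using assms
proof (induction k arbitrary: \<phi> \<psi>)
  case 0
  then show ?case by simp
next
  case (Suc k)
  have "monotone_upto k (backward_diff d (\<lambda>s. \<phi> s * \<psi> s))" for d
  proof -
    have "backward_diff d (\<lambda>s. \<phi> s * \<psi> s) =
        (\<lambda>s. backward_diff d \<phi> s * \<psi> s + \<phi> (s + d) * backward_diff d \<psi> s)"
      by (simp add: backward_diff_def fun_eq_iff algebra_simps)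
    moreover have "monotone_upto k (\<lambda>s. backward_diff d \<phi> s * \<psi> s)"
      using Suc.prems by (intro Suc.IH) (auto intro: monotone_upto_SucD)
    moreover have "monotone_upto k (\<lambda>s. \<phi> (s + d) * backward_diff d \<psi> s)"
      using Suc.prems
      by (intro Suc.IH monotone_upto_shift) (auto intro: monotone_upto_SucD)
    ultimately show ?thesis
      by (simp add: monotone_upto_add)
  qed
  with Suc.prems show ?case by simp
qed

lemma monotone_upto_inverse:
  assumes pos: "\<And>s. 0 < f s"
    and incr: "\<And>k d. monotone_upto k (\<lambda>s. f (s + d) - f s)"
  shows "monotone_upto k (\<lambda>s. 1 / f s)"
proof (induction k)
  case 0
  then show ?case using pos by (simp add: less_imp_le)
next
  case (Suc k)
  have "monotone_upto k (backward_diff d (\<lambda>s. 1 / f s))" for d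
  proof -
    have "backward_diff d (\<lambda>s. 1 / f s) = (\<lambda>s. (f (s + d) - f s) * (1 / f s * (1 / f (s + d))))"
      using pos by (simp add: backward_diff_def fun_eq_iff field_simps less_imp_neq [symmetric])
    then show ?thesis
      by (simp only:) (intro monotone_upto_mult incr Suc.IH monotone_upto_shift[OF Suc.IH])
  qed
  then show ?case using pos by (simp add: less_imp_le)
qed

lemma monotone_upto_reciprocal_linear:
  assumes "0 < a"
  shows "monotone_upto k (\<lambda>s. 1 / (real (fst s) + a))"
  by (rule monotone_upto_inverse) (use assms in \<open>auto simp: monotone_upto_const\<close>)

text \<open>Sufficiency for all three families: increments of \<open>r m + real n\<close> are a
  nonnegative constant plus a difference of \<open>g\<close>. The slope \<open>e\<close> is 1 in the
  second family and 0 in the others.\<close>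

lemma completely_monotone_reciprocal:
  assumes pos: "\<And>m. 0 < r m"
    and r: "\<And>m. r m = e * real m + K - g (m, 0)" and "0 \<le> e"
    and g: "\<And>k. monotone_upto k g" "\<And>m n. g (m, n) = g (m, 0)"
    and \<phi>: "\<And>m n. \<phi> (m, n) = 1 / (r m + real n)"
  shows "\<phi> \<in> completely_monotone"
proof -
  define f where "f = (\<lambda>s. r (fst s) + real (snd s))"
  have "monotone_upto k (\<lambda>s. f (s + d) - f s)" for k d
  proof -
    have "f (s + d) - f s = (e * real (fst d) + real (snd d)) + backward_diff d g s" for s
    proof -
      have "g s = g (fst s, 0)" "g (s + d) = g (fst (s + d), 0)"
        using g(2) by (metis prod.collapse)+
      then show ?thesis
        by (simp add: f_def r backward_diff_def algebra_simps)
    qed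
    moreover have "monotone_upto k (backward_diff d g)"
      using g(1)[of "Suc k"] by simp
    ultimately show ?thesis
      using \<open>0 \<le> e\<close> by (simp add: monotone_upto_add monotone_upto_const)
  qed
  moreover have "0 < f s" for s
    using pos by (simp add: f_def add_pos_nonneg)
  ultimately have "monotone_upto k (\<lambda>s. 1 / f s)" for k
    by (rule monotone_upto_inverse[rotated])
  moreover have "\<phi> = (\<lambda>s. 1 / f s)"
    using \<phi> by (auto simp: f_def)
  ultimately show ?thesis
    by (simp add: completely_monotoneI)
qed

section \<open>Differences of sequences\<close>

text \<open>One-variable form of \<open>backward_diff (1, 0)\<close>, the only direction that the
  necessity proofs use.\<close>

definition nabla :: "(nat \<Rightarrow> real) \<Rightarrow> nat \<Rightarrow> real"
  where "nabla f = (\<lambda>m. f m - f (Suc m))"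

lemma nabla_pow_linear:
  "(nabla ^^ k) (\<lambda>m. c * f m + d * g m) = (\<lambda>m. c * (nabla ^^ k) f m + d * (nabla ^^ k) g m)"
  by (induction k) (auto simp: nabla_def algebra_simps)

lemma nabla_pow_const: "(nabla ^^ Suc k) (\<lambda>m. c) = (\<lambda>m. 0)"
  by (induction k) (auto simp: nabla_def)

text \<open>Leibniz rule for a factor whose first difference is -1 and whose second is 0, so two
  terms remain.\<close>

lemma nabla_pow_mult_linear:
  "(nabla ^^ Suc k) (\<lambda>m. (real m + a) * w m) m =
     (real m + a) * (nabla ^^ Suc k) w m - real (Suc k) * (nabla ^^ k) w (Suc m)"
proof (induction k arbitrary: m)
  case 0
  then show ?case by (simp add: nabla_def algebra_simps)
next
  case (Suc k)
  have "(nabla ^^ Suc (Suc k)) (\<lambda>m. (real m + a) * w m) m =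
      nabla ((nabla ^^ Suc k) (\<lambda>m. (real m + a) * w m)) m"
    by simp
  also have "\<dots> = nabla (\<lambda>m. (real m + a) * (nabla ^^ Suc k) w m
      - real (Suc k) * (nabla ^^ k) w (Suc m)) m"
    by (simp only: ext[OF Suc.IH])
  also have "\<dots> = (real m + a) * (nabla ^^ Suc (Suc k)) w m
      - real (Suc (Suc k)) * (nabla ^^ Suc k) w (Suc m)"
    by (simp add: nabla_def algebra_simps)
  finally show ?case .
qed

lemma tendsto_nabla_pow:
  assumes "\<And>m. (\<lambda>n. F n m) \<longlonglongrightarrow> G m"
  shows "(\<lambda>n. (nabla ^^ k) (F n) m) \<longlonglongrightarrow> (nabla ^^ k) G m"
proof (induction k arbitrary: m)
  case 0
  then show ?case using assms by simp
next
  case (Suc k)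
  then show ?case by (simp add: nabla_def tendsto_diff)
qed

section \<open>Necessary conditions from the limit in the second coordinate\<close>

lemma nabla_pow_nonneg:
  assumes "\<phi> \<in> completely_monotone"
  shows "0 \<le> (nabla ^^ k) (\<lambda>m. \<phi> (m, n)) m"
proof -
  have "(nabla ^^ k) (\<lambda>m. \<phi> (m, n)) m = foldr backward_diff (replicate k (1, 0)) \<phi> (m, n)"
    by (induction k arbitrary: m) (auto simp: nabla_def backward_diff_def)
  moreover have "0 \<le> foldr backward_diff (replicate k (1, 0)) \<phi> (m, n)"
    using assms unfolding completely_monotone_def by blast
  ultimately show ?thesis by simp
qed

lemma nabla_pow_nonpos:
  assumes cm: "\<phi> \<in> completely_monotone"
    and \<phi>: "\<And>m n. \<phi> (m, n) = 1 / (r m + real n)"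
  shows "(nabla ^^ Suc k) r m \<le> 0"
proof -
  \<comment> \<open>The first difference is
    \<open>(r (Suc m) - r m) / ((r m + n) * (r (Suc m) + n))\<close>, hence the factor
    \<open>n^2\<close>. The other \<open>k\<close> differences are finite combinations of values and
    pass to the limit.\<close>
  have lim: "(\<lambda>n. (real n)\<^sup>2 * nabla (\<lambda>m. \<phi> (m, n)) m) \<longlonglongrightarrow> - nabla r m" for m
  proof -
    have "(\<lambda>n. (real n)\<^sup>2 * (1 / (x + real n) - 1 / (y + real n))) \<longlonglongrightarrow> y - x" for x y :: real
      by real_asymp
    from this[of "r m" "r (Suc m)"] show ?thesis
      by (simp add: nabla_def \<phi>)
  qed
  have "(\<lambda>n. (nabla ^^ k) (\<lambda>m. (real n)\<^sup>2 * nabla (\<lambda>m. \<phi> (m, n)) m) m)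
      \<longlonglongrightarrow> (nabla ^^ k) (\<lambda>m. - nabla r m) m"
    by (rule tendsto_nabla_pow) (rule lim)
  \<comment> \<open>The coefficient 0 reduces \<open>nabla_pow_linear\<close> to scaling.\<close>
  moreover have "(nabla ^^ k) (\<lambda>m. - nabla r m) m = - (nabla ^^ Suc k) r m"
    using nabla_pow_linear[of k "-1" "nabla r" 0 "nabla r"] by (simp add: funpow_swap1)
  moreover have "0 \<le> (nabla ^^ k) (\<lambda>m. (real n)\<^sup>2 * nabla (\<lambda>m. \<phi> (m, n)) m) m" for n
    using nabla_pow_linear[of k "(real n)\<^sup>2" "nabla (\<lambda>m. \<phi> (m, n))" 0 "nabla r"]
      nabla_pow_nonneg[OF cm, of "Suc k" n m]
    by (simp add: funpow_swap1)
  ultimately have "0 \<le> - (nabla ^^ Suc k) r m"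
    by (intro LIMSEQ_le_const[where a = 0]) (simp_all only:, blast)
  then show ?thesis by simp
qed

section \<open>Growth of the differences of reciprocals\<close>

lemma sum_reciprocal_diverges:
  fixes c :: real
  assumes "0 < a"
  obtains k where "c < (\<Sum>i\<le>Suc k. 1 / (real i + a))"
proof -
  have "\<not> summable (\<lambda>i. 1 / (real i + a))"
  proof
    assume *: "summable (\<lambda>i. 1 / (real i + a))"
    have "summable (\<lambda>i. inverse (real i))"
    proof (rule summable_comparison_test_bigo)
      show "summable (\<lambda>i. norm (1 / (real i + a)))"
        using * assms by simp
      show "(\<lambda>i. inverse (real i)) \<in> O(\<lambda>i. 1 / (real i + a))"
        by real_asymp
    qed
    then show False
      using not_summable_harmonic[where 'a = real] by simp
  qed
  then obtain k where "c < (\<Sum>i\<le>k. 1 / (real i + a))"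
    using assms bounded_imp_summable[of "\<lambda>i. 1 / (real i + a)" c]
    by (force simp: not_le [symmetric])
  \<comment> \<open>The extra term makes the order positive, as \<open>nabla_pow_nonpos\<close>
    requires.\<close>
  also have "\<dots> \<le> (\<Sum>i\<le>Suc k. 1 / (real i + a))"
    using assms by (intro sum_mono2) auto
  finally show thesis by (rule that)
qed

text \<open>The product with the linear factor is the constant 1, whose differences of positive
  order vanish.\<close>

lemma nabla_pow_reciprocal_linear_rec:
  assumes "0 < a"
  shows "(real m + a) * (nabla ^^ Suc k) (\<lambda>m. 1 / (real m + a)) m =
    real (Suc k) * (nabla ^^ k) (\<lambda>m. 1 / (real m + a)) (Suc m)"
proof -
  have "(\<lambda>m. (real m + a) * (1 / (real m + a))) = (\<lambda>m. 1)"
    using assms by (auto simp: fun_eq_iff add_nonneg_pos less_imp_neq [symmetric])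
  then have "(nabla ^^ Suc k) (\<lambda>m. (real m + a) * (1 / (real m + a))) m = 0"
    by (simp only: nabla_pow_const)
  then show ?thesis
    using nabla_pow_mult_linear[of k a "\<lambda>m. 1 / (real m + a)" m] by linarith
qed

lemma nabla_pow_reciprocal_linear_pos:
  assumes "0 < a"
  shows "0 < (nabla ^^ k) (\<lambda>m. 1 / (real m + a)) m"
proof (induction k arbitrary: m)
  case 0
  then show ?case using assms by (simp add: add_nonneg_pos)
next
  case (Suc k)
  have "0 < (real m + a) * (nabla ^^ Suc k) (\<lambda>m. 1 / (real m + a)) m"
    unfolding nabla_pow_reciprocal_linear_rec[OF assms] using Suc.IH[of "Suc m"] by simp
  then show ?case
    using assms by (simp add: zero_less_mult_iff add_nonneg_pos)
qed

text \<open>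
  Applying \<open>\<nabla>\<^sup>k\<close> to \<open>(m + a) w(m) = v(m)\<close> for \<open>w = 1 / ((m + a)(m + b))\<close> and \<open>v = 1 / (m + b)\<close>
  gives \<open>(m + a) \<rho>\<^sub>k(m) = 1 + (m + b) \<rho>\<^bsub>k-1\<^esub>(m + 1)\<close> for the ratio \<open>\<rho>\<^sub>k = \<nabla>\<^sup>k w / \<nabla>\<^sup>k v\<close>.
\<close>

lemma nabla_pow_reciprocal_product_ge:
  assumes "0 < a" and "a \<le> b"
  shows "(\<Sum>i\<le>k. 1 / (real i + (real m + a))) * (nabla ^^ k) (\<lambda>m. 1 / (real m + b)) m
    \<le> (nabla ^^ k) (\<lambda>m. 1 / ((real m + a) * (real m + b))) m"
proof (induction k arbitrary: m)
  case 0
  then show ?case by simp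
next
  case (Suc k)
  define v where "v = (\<lambda>m. 1 / (real m + b))"
  define w where "w = (\<lambda>m. 1 / ((real m + a) * (real m + b)))"
  \<comment> \<open>Adding the term \<open>1 / (real m + a)\<close> to \<open>H\<close> gives the
    sum for \<open>Suc k\<close> at \<open>m\<close>.\<close>
  define H where "H = (\<Sum>i\<le>k. 1 / (real i + (real (Suc m) + a)))"
  have ma: "0 < real m + a" using assms by simp
  have "(\<lambda>m. (real m + a) * w m) = v"
    using assms by (auto simp: fun_eq_iff v_def w_def add_nonneg_pos less_imp_neq [symmetric])
  then have w_rec: "(real m + a) * (nabla ^^ Suc k) w m =
      (nabla ^^ Suc k) v m + real (Suc k) * (nabla ^^ k) w (Suc m)"
    using nabla_pow_mult_linear[of k a w m] by (simp only: diff_add_cancel)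
  have v_rec: "(real m + b) * (nabla ^^ Suc k) v m = real (Suc k) * (nabla ^^ k) v (Suc m)"
    using nabla_pow_reciprocal_linear_rec[of b m k] assms by (simp add: v_def)
  have v_pos: "0 < (nabla ^^ Suc k) v m"
    using nabla_pow_reciprocal_linear_pos[of b "Suc k" m] assms unfolding v_def by simp
  have H_nonneg: "0 \<le> H"
    unfolding H_def using assms by (intro sum_nonneg) simp
  \<comment> \<open>By \<open>a \<le> b\<close>, the factor \<open>(m + b) / (m + a)\<close> in the
    recursion for the ratio is at least 1.\<close>
  have "(real m + a) * (H * (nabla ^^ Suc k) v m) \<le> (real m + b) * (H * (nabla ^^ Suc k) v m)"
    using assms H_nonneg v_pos by (intro mult_right_mono) auto
  also have "\<dots> = H * (real (Suc k) * (nabla ^^ k) v (Suc m))"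
    by (simp only: v_rec [symmetric] mult_ac)
  also have "\<dots> = real (Suc k) * (H * (nabla ^^ k) v (Suc m))"
    by (simp only: mult_ac)
  also have "\<dots> \<le> real (Suc k) * (nabla ^^ k) w (Suc m)"
    using Suc.IH[of "Suc m"] by (intro mult_left_mono) (simp_all only: H_def v_def w_def of_nat_0_le_iff)
  finally have "(nabla ^^ Suc k) v m + (real m + a) * (H * (nabla ^^ Suc k) v m)
      \<le> (real m + a) * (nabla ^^ Suc k) w m"
    unfolding w_rec by linarith
  moreover have "x * ((1 / x + H) * y) = y + x * (H * y)" if "0 < x" for x y
    using that by (simp add: field_simps)
  ultimately have "(real m + a) * ((1 / (real m + a) + H) * (nabla ^^ Suc k) v m)
      \<le> (real m + a) * (nabla ^^ Suc k) w m"
    using ma by (simp only:)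
  then have "(1 / (real m + a) + H) * (nabla ^^ Suc k) v m \<le> (nabla ^^ Suc k) w m"
    using ma by simp
  moreover have "(\<Sum>i\<le>Suc k. 1 / (real i + (real m + a))) = 1 / (real m + a) + H"
    unfolding H_def by (subst sum.atMost_Suc_shift) (simp add: add_ac)
  ultimately show ?case
    by (simp only: v_def w_def)
qed

section \<open>The three families\<close>

lemma divide_add_eq_reciprocal:
  fixes x y z :: real
  assumes "0 < x"
  shows "x / (y + x * z) = 1 / (y / x + z)"
proof -
  have "y / x + z = (y + x * z) / x"
    using assms by (simp add: add_divide_distrib)
  then show ?thesis by simp
qed

text \<open>Since \<open>r m = 1 - (a - b) / (m + a)\<close>, the sign of \<open>a - b\<close>
  decides, and the first difference at 0 detects it.\<close>

lemma completely_monotone_linear_iff: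
  assumes "0 < a" and "0 < b"
  shows "(\<lambda>(m, n). (real m + a) / ((real m + b) + (real m + a) * real n))
    \<in> completely_monotone \<longleftrightarrow> b \<le> a" (is "?\<phi> \<in> _ \<longleftrightarrow> _")
proof -
  define r where "r = (\<lambda>m. (real m + b) / (real m + a))"
  have nz: "0 < real m + a" "0 < real m + b" for m
    using assms by simp_all
  have r_pos: "0 < r m" for m
    using nz by (simp add: r_def)
  have \<phi>: "?\<phi> (m, n) = 1 / (r m + real n)" for m n
    using nz[of m] by (simp add: r_def divide_add_eq_reciprocal)
  have r: "r m = 1 - (a - b) * (1 / (real m + a))" for m
    using nz[of m] by (simp add: r_def divide_simps)
  show ?thesis
  proof
    assume "?\<phi> \<in> completely_monotone"
    from nabla_pow_nonpos[OF this \<phi>, of 0 0] have "r 0 \<le> r 1"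
      by (simp add: nabla_def)
    then have "(b - a) * (1 / a - 1 / (1 + a)) \<le> 0"
      by (simp add: r algebra_simps diff_divide_distrib)
    moreover have "0 < 1 / a - 1 / (1 + a)"
      using assms by (simp add: divide_simps)
    ultimately show "b \<le> a"
      by (simp add: mult_le_0_iff)
  next
    assume "b \<le> a"
    then have g: "monotone_upto k (\<lambda>s. (a - b) * (1 / (real (fst s) + a)))" for k
      using assms
      by (intro monotone_upto_mult monotone_upto_const monotone_upto_reciprocal_linear) auto
    show "?\<phi> \<in> completely_monotone"
    proof (rule completely_monotone_reciprocal[OF r_pos _ _ g _ \<phi>])
      show "r m = 0 * real m + 1 - (a - b) * (1 / (real (fst (m, 0::nat)) + a))" for m
        using r[of m] by simp
    qed auto
  qed
qed

lemma between_iff_mult_nonneg: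
  fixes a b c :: real
  assumes "b \<le> c"
  shows "b \<le> a \<and> a \<le> c \<longleftrightarrow> 0 \<le> (a - b) * (c - a)"
  using assms by (auto simp: zero_le_mult_iff)

lemma completely_monotone_quadratic_linear_iff:
  assumes "0 < a" and "0 < b1" and "0 < b2" and "b1 \<le> b2"
  shows "(\<lambda>(m, n). (real m + a) / ((real m + b1) * (real m + b2) + (real m + a) * real n))
    \<in> completely_monotone \<longleftrightarrow> b1 \<le> a \<and> a \<le> b2" (is "?\<phi> \<in> _ \<longleftrightarrow> _")
proof -
  define p where "p = (a - b1) * (b2 - a)"
  define r where "r = (\<lambda>m. (real m + b1) * (real m + b2) / (real m + a))"
  have nz: "0 < real m + a" "0 < real m + b1" "0 < real m + b2" for m
    using assms by simp_all
  have r_pos: "0 < r m" for m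
    using nz by (simp add: r_def)
  have \<phi>: "?\<phi> (m, n) = 1 / (r m + real n)" for m n
    using nz[of m] by (simp add: r_def divide_add_eq_reciprocal)
  have r: "r m = 1 * real m + (b1 + b2 - a) - p * (1 / (real m + a))" for m
    using nz[of m] by (simp add: r_def p_def divide_simps) (simp add: algebra_simps)
  have "?\<phi> \<in> completely_monotone \<longleftrightarrow> 0 \<le> p"
  proof
    assume "?\<phi> \<in> completely_monotone"
    \<comment> \<open>The second difference removes the linear part of \<open>r\<close> and leaves
      \<open>- p\<close> times a positive number.\<close>
    from nabla_pow_nonpos[OF this \<phi>, of 1 0] have "r 0 - 2 * r 1 + r 2 \<le> 0"
      by (simp add: nabla_def numeral_2_eq_2)
    then have "p * (1 / a - 2 / (1 + a) + 1 / (2 + a)) \<ge> 0"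
      by (simp add: r algebra_simps)
    moreover have "1 / a - 2 / (1 + a) + 1 / (2 + a) = 2 / (a * (1 + a) * (2 + a))"
      using assms by (simp add: divide_simps) (simp add: algebra_simps)
    moreover have "0 < 2 / (a * (1 + a) * (2 + a))"
      using assms by simp
    ultimately show "0 \<le> p"
      by (metis mult.commute zero_le_mult_iff not_le)
  next
    assume "0 \<le> p"
    then have g: "monotone_upto k (\<lambda>s. p * (1 / (real (fst s) + a)))" for k
      using assms
      by (intro monotone_upto_mult monotone_upto_const monotone_upto_reciprocal_linear) auto
    show "?\<phi> \<in> completely_monotone"
    proof (rule completely_monotone_reciprocal[OF r_pos _ _ g _ \<phi>])
      show "r m = 1 * real m + (b1 + b2 - a) - p * (1 / (real (fst (m, 0::nat)) + a))" for m
        using r[of m] by simp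
    qed auto
  qed
  with between_iff_mult_nonneg[OF \<open>b1 \<le> b2\<close>] show ?thesis
    by (simp add: p_def)
qed

section \<open>Quotients of two quadratic polynomials\<close>

context
  fixes a1 a2 b1 b2 :: real and r :: "nat \<Rightarrow> real" and \<phi> :: "nat \<times> nat \<Rightarrow> real"
  assumes pos: "0 < a1" "0 < a2" "0 < b1" "0 < b2"
  defines "r \<equiv> \<lambda>m. (real m + b1) * (real m + b2) / ((real m + a1) * (real m + a2))"
    and "\<phi> \<equiv> \<lambda>(m, n). ((real m + a1) * (real m + a2)) /
            ((real m + b1) * (real m + b2) + (real m + a1) * (real m + a2) * real n)"
begin

lemma quadratic_net_eq: "\<phi> (m, n) = 1 / (r m + real n)"
proof -
  have "0 < (real m + a1) * (real m + a2)"
    using pos by simp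
  then show ?thesis
    by (simp only: \<phi>_def r_def case_prod_conv divide_add_eq_reciprocal)
qed

text \<open>Unlike partial fractions, this expansion allows \<open>a1 = a2\<close>, and the
  conditions to be proved are sign conditions on its two coefficients.\<close>

lemma quadratic_ratio_eq:
  "r m = 1 - ((a1 - b1) * (b2 - a1) * (1 / ((real m + a1) * (real m + a2)))
    + (a1 + a2 - b1 - b2) * (1 / (real m + a2)))"
proof -
  have "0 < real m + a1" "0 < real m + a2"
    using pos by simp_all
  then show ?thesis
    by (simp add: r_def divide_simps) (simp add: algebra_simps)
qed

lemma quadratic_net_completely_monotone:
  assumes "0 \<le> (a1 - b1) * (b2 - a1)" and "b1 + b2 \<le> a1 + a2"
  shows "\<phi> \<in> completely_monotone"
proof -
  define g where "g = (\<lambda>s::nat \<times> nat.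
    (a1 - b1) * (b2 - a1) * (1 / (real (fst s) + a1) * (1 / (real (fst s) + a2)))
    + (a1 + a2 - b1 - b2) * (1 / (real (fst s) + a2)))"
  show ?thesis
  proof (rule completely_monotone_reciprocal[where e = 0 and K = 1 and g = g and r = r])
    show "0 < r m" for m
      using pos by (simp add: r_def)
    show "monotone_upto k g" for k
      unfolding g_def using assms pos
      by (intro monotone_upto_add monotone_upto_mult monotone_upto_const
          monotone_upto_reciprocal_linear) auto
    show "r m = 0 * real m + 1 - g (m, 0)" for m
      by (subst quadratic_ratio_eq) (simp add: g_def)
  qed (auto simp: g_def quadratic_net_eq)
qed

text \<open>\<open>b1 + b2 - a1 - a2\<close> is the coefficient of \<open>1 / m\<close> in
  \<open>r m - 1\<close> for large \<open>m\<close>, and the increasing \<open>r\<close> stays below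
  its limit 1.\<close>

lemma quadratic_net_sum_le:
  assumes "\<phi> \<in> completely_monotone"
  shows "b1 + b2 \<le> a1 + a2"
proof -
  have r_mono: "r m \<le> r (Suc m)" for m
    using nabla_pow_nonpos[OF assms quadratic_net_eq, of 0 m] by (simp add: nabla_def)
  have "r \<longlonglongrightarrow> 1"
    unfolding r_def by real_asymp
  with r_mono have "r m \<le> 1" for m
    by (intro incseq_le) (auto simp: incseq_Suc_iff)
  then have "real m * (r m - 1) \<le> 0" for m
    by (simp add: mult_nonneg_nonpos)
  moreover have "(\<lambda>m. real m * (r m - 1)) \<longlonglongrightarrow> b1 + b2 - a1 - a2"
    unfolding r_def by real_asymp
  ultimately have "b1 + b2 - a1 - a2 \<le> 0"
    by (intro LIMSEQ_le_const2) auto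
  then show ?thesis by simp
qed

lemma quadratic_net_product_nonneg:
  assumes "\<phi> \<in> completely_monotone" and "a1 \<le> a2"
  shows "0 \<le> (a1 - b1) * (b2 - a1)"
proof (rule ccontr)
  define p where "p = (a1 - b1) * (b2 - a1)"
  define q where "q = a1 + a2 - b1 - b2"
  define v where "v = (\<lambda>m. 1 / (real m + a2))"
  define w where "w = (\<lambda>m. 1 / ((real m + a1) * (real m + a2)))"
  assume "\<not> 0 \<le> (a1 - b1) * (b2 - a1)"
  then have p: "p < 0" by (simp add: p_def)
  \<comment> \<open>For \<open>p < 0\<close>, complete monotonicity bounds the ratio of the
    differences of \<open>w\<close> and \<open>v\<close> by \<open>q / (- p)\<close>; at this order
    the ratio exceeds that bound.\<close>
  obtain k where k: "q / (- p) < (\<Sum>i\<le>Suc k. 1 / (real i + a1))"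
    by (rule sum_reciprocal_diverges[OF pos(1)])
  have v_pos: "0 < (nabla ^^ Suc k) v 0"
    unfolding v_def by (rule nabla_pow_reciprocal_linear_pos) (rule pos)
  \<comment> \<open>The shape matches \<open>nabla_pow_linear\<close> with the constant 1 as first
    function.\<close>
  have "r = (\<lambda>m. 1 * 1 + (-1) * (p * w m + q * v m))"
    using quadratic_ratio_eq by (simp add: p_def q_def v_def w_def fun_eq_iff)
  then have "(nabla ^^ Suc k) r 0 = - (p * (nabla ^^ Suc k) w 0 + q * (nabla ^^ Suc k) v 0)"
    by (simp only: nabla_pow_linear nabla_pow_const) simp
  then have "(- p) * (nabla ^^ Suc k) w 0 \<le> q * (nabla ^^ Suc k) v 0"
    using nabla_pow_nonpos[OF assms(1) quadratic_net_eq, of k 0] by linarith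
  also have "\<dots> < (- p) * ((\<Sum>i\<le>Suc k. 1 / (real i + a1)) * (nabla ^^ Suc k) v 0)"
  proof -
    have "q < (- p) * (\<Sum>i\<le>Suc k. 1 / (real i + a1))"
      using k p by (simp only: pos_divide_less_eq neg_0_less_iff_less mult.commute)
    from mult_strict_right_mono[OF this v_pos] show ?thesis
      by (simp only: mult.assoc)
  qed
  also have "\<dots> \<le> (- p) * (nabla ^^ Suc k) w 0"
    using nabla_pow_reciprocal_product_ge[OF pos(1) assms(2), of 0 "Suc k"] p
    by (intro mult_left_mono) (simp_all only: v_def w_def of_nat_0 add_0_left
        neg_0_le_iff_le less_imp_le)
  finally show False by simp
qed

lemma quadratic_net_completely_monotone_iff:
  assumes "a1 \<le> a2" and "b1 \<le> b2"
  shows "\<phi> \<in> completely_monotone \<longleftrightarrow> b1 \<le> a1 \<and> a1 \<le> b2 \<and> b1 + b2 \<le> a1 + a2"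
  using quadratic_net_completely_monotone quadratic_net_sum_le
    quadratic_net_product_nonneg[OF _ assms(1)] between_iff_mult_nonneg[OF assms(2), of a1]
  by blast

end

text \<open>The second net is symmetric in \<open>b1\<close> and \<open>b2\<close>, the third also
  in \<open>a1\<close> and \<open>a2\<close>, but the inequalities are not; hence the orderings in
  the equivalences. The last conjunct gives sufficiency for either order of \<open>a1\<close> and
  \<open>a2\<close>.\<close>

theorem corollary3p9:
  fixes a1 a2 b1 b2 :: real
  assumes "0 < a1" and "0 < a2" and "0 < b1" and "0 < b2"
  shows
    "((\<lambda>(m, n). (real m + a1) / ((real m + b1) + (real m + a1) * real n))
        \<in> completely_monotone \<longleftrightarrow> b1 \<le> a1)
     \<and>
     (b1 \<le> b2 \<longrightarrow>
       ((\<lambda>(m, n). (real m + a1) / ((real m + b1) * (real m + b2) + (real m + a1) * real n))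
          \<in> completely_monotone \<longleftrightarrow> b1 \<le> a1 \<and> a1 \<le> b2))
     \<and>
     (a1 \<le> a2 \<and> b1 \<le> b2 \<longrightarrow>
       ((\<lambda>(m, n). ((real m + a1) * (real m + a2)) /
            ((real m + b1) * (real m + b2) + (real m + a1) * (real m + a2) * real n))
          \<in> completely_monotone \<longleftrightarrow> b1 \<le> a1 \<and> a1 \<le> b2 \<and> b1 + b2 \<le> a1 + a2))
     \<and>
     (b1 \<le> a1 \<and> a1 \<le> b2 \<and> b1 + b2 \<le> a1 + a2 \<longrightarrow>
       (\<lambda>(m, n). ((real m + a1) * (real m + a2)) /
            ((real m + b1) * (real m + b2) + (real m + a1) * (real m + a2) * real n))
          \<in> completely_monotone)"
proof (intro conjI impI)
  show "((\<lambda>(m, n). (real m + a1) / ((real m + b1) + (real m + a1) * real n))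
        \<in> completely_monotone \<longleftrightarrow> b1 \<le> a1)"
    using assms by (intro completely_monotone_linear_iff)
next
  assume "b1 \<le> b2"
  then show "(\<lambda>(m, n). (real m + a1) / ((real m + b1) * (real m + b2) + (real m + a1) * real n))
          \<in> completely_monotone \<longleftrightarrow> b1 \<le> a1 \<and> a1 \<le> b2"
    using assms by (intro completely_monotone_quadratic_linear_iff)
next
  assume "a1 \<le> a2 \<and> b1 \<le> b2"
  then show "(\<lambda>(m, n). ((real m + a1) * (real m + a2)) /
            ((real m + b1) * (real m + b2) + (real m + a1) * (real m + a2) * real n))
          \<in> completely_monotone \<longleftrightarrow> b1 \<le> a1 \<and> a1 \<le> b2 \<and> b1 + b2 \<le> a1 + a2"
    using assms by (intro quadratic_net_completely_monotone_iff) auto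
next
  assume "b1 \<le> a1 \<and> a1 \<le> b2 \<and> b1 + b2 \<le> a1 + a2"
  then show "(\<lambda>(m, n). ((real m + a1) * (real m + a2)) /
            ((real m + b1) * (real m + b2) + (real m + a1) * (real m + a2) * real n))
          \<in> completely_monotone"
    using assms by (intro quadratic_net_completely_monotone) auto
qed

end
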